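(* Let $(X_i^n)_{n\ge 1,\ 1\le i\le n}$ be a triangular array of real random variables, all independent, such that for each $n\ge 1$ the variables $X_1^n,\dots,X_n^n$ of the $n$-th row have the same law $\mu_n$. Assume that each $\mu_n$ has mean zero, variance $1$, and that the third absolute moments $m_n=\int_{\mathbb{R}}|x|^3\,\mu_n(dx)$ satisfy $$\sum_{n=1}^{\infty}\frac{m_n}{n^2}<\infty.$$ For $N\ge 1$ let $$Z_N=\sum_{n=1}^{N}\frac{1}{n}\left(X_1^n+\cdots+X_n^n\right),\qquad H_N=\sum_{n=1}^N\frac1n.$$ Then the sequence $(Z_N)$ strongly converges in the mod-Gaussian sense with parameters $(0,H_N)$, and also with parameters $(0,\log N)$.
   Context: A sequence $(Z_N)$ of real random variables converges in the mod-Gaussian sense with parameters $(\beta_N,\gamma_N)$ (where $\beta_N\in\mathbb{R}$, $\gamma_N\ge 0$) and limiting function $\Phi$ if $$e^{-iu\beta_N+u^2\gamma_N/2}\,\mathbb{E}[e^{iuZ_N}]\to\Phi(u)\quad (N\to\infty)$$ for every $u\in\mathbb{R}$, where $\Phi:\mathbb{R}\to\mathbb{C}$ is a function continuous at $0$. It strongly converges in the mod-Gaussian sense if this convergence is uniform in $u$ on every compact subset of $\mathbb{R}$. When no limiting function is specified, the assertion is that some such $\Phi$ exists. *)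

theory Defs
  imports "HOL-Probability.Probability"
begin

context prob_space
begin

definition mod_gaussian_char ::
    "(nat \<Rightarrow> 'a \<Rightarrow> real) \<Rightarrow> (nat \<Rightarrow> real) \<Rightarrow> (nat \<Rightarrow> real) \<Rightarrow> nat \<Rightarrow> real \<Rightarrow> complex" where
  "mod_gaussian_char Z \<beta> \<gamma> N u =
     exp (- \<i> * of_real (u * \<beta> N) + of_real (u\<^sup>2 * \<gamma> N / 2))
       * expectation (\<lambda>\<omega>. exp (\<i> * of_real (u * Z N \<omega>)))"

text \<open>Sequences are indexed by \<open>N \<ge> 1\<close>; the values at \<open>N = 0\<close> are irrelevant.\<close>

definition mod_gaussian_converges ::
    "(nat \<Rightarrow> 'a \<Rightarrow> real) \<Rightarrow> (nat \<Rightarrow> real) \<Rightarrow> (nat \<Rightarrow> real) \<Rightarrow> (real \<Rightarrow> complex) \<Rightarrow> bool" where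
  "mod_gaussian_converges Z \<beta> \<gamma> \<Phi> \<longleftrightarrow>
     (\<forall>N\<ge>1. random_variable borel (Z N)) \<and>
     (\<forall>N\<ge>1. 0 \<le> \<gamma> N) \<and>
     isCont \<Phi> 0 \<and>
     (\<forall>u. (\<lambda>N. mod_gaussian_char Z \<beta> \<gamma> N u) \<longlonglongrightarrow> \<Phi> u)"

definition strongly_mod_gaussian_converges ::
    "(nat \<Rightarrow> 'a \<Rightarrow> real) \<Rightarrow> (nat \<Rightarrow> real) \<Rightarrow> (nat \<Rightarrow> real) \<Rightarrow> (real \<Rightarrow> complex) \<Rightarrow> bool" where
  "strongly_mod_gaussian_converges Z \<beta> \<gamma> \<Phi> \<longleftrightarrow>
     mod_gaussian_converges Z \<beta> \<gamma> \<Phi> \<and>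
     (\<forall>K. compact K \<longrightarrow> uniform_limit K (mod_gaussian_char Z \<beta> \<gamma>) \<Phi> sequentially)"

end

end

theory Submission
  imports Defs
begin

text \<open>By independence, the renormalised characteristic function of \<open>Z N\<close> is the product over
  \<open>n \<le> N\<close> of \<open>exp (u\<^sup>2 / (2 n)) \<phi>\<^sub>n(u / n)\<^sup>n\<close>, where \<open>\<phi>\<^sub>n\<close> is the characteristic
  function of \<open>\<mu> n\<close>. Comparing \<open>\<phi>\<^sub>n(t)\<close> and \<open>exp (- t\<^sup>2 / 2)\<close> through \<open>1 - t\<^sup>2 / 2\<close> shows that each factor
  differs from 1 by at most a constant times \<open>m n / n\<^sup>2 + 1 / n\<^sup>3\<close>, uniformly for bounded \<open>u\<close>, so the
  product converges uniformly. Replacing \<open>harm N\<close> by \<open>ln N\<close> multiplies it by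
  \<open>exp (u\<^sup>2 (ln N - harm N) / 2)\<close>, which converges because \<open>harm N - ln N\<close> tends to Euler's constant.\<close>

text \<open>The lower bound is \<open>1 - x \<le> exp (- x)\<close>. The upper bound
  \<open>exp (- x) \<le> 1 - x + x\<^sup>2 / 2\<close> follows from the quadratic Taylor bound for
  \<open>exp x\<close>, since the two quadratics multiply to 1 + x^4 / 4, which is at least
  1.\<close>

lemma exp_minus_approx2:
  fixes x :: real
  assumes "0 \<le> x"
  shows "\<bar>1 - x - exp (- x)\<bar> \<le> x\<^sup>2 / 2"
proof -
  have "1 + x + x\<^sup>2 / 2 \<le> exp x"
    using exp_lower_Taylor_quadratic[OF assms] by simp
  \<comment> \<open>The right-hand side is half of (1 - x)^2 + 1^2.\<close>
  moreover have "0 \<le> 1 - x + x\<^sup>2 / 2"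
    using sum_squares_ge_zero[of "1 - x" 1] by (simp add: power2_eq_square field_simps)
  ultimately have "(1 - x + x\<^sup>2 / 2) * (1 + x + x\<^sup>2 / 2) \<le> (1 - x + x\<^sup>2 / 2) * exp x"
    by (intro mult_left_mono)
  moreover have "(1 - x + x\<^sup>2 / 2) * (1 + x + x\<^sup>2 / 2) = 1 + (x\<^sup>2)\<^sup>2 / 4"
    by (simp add: power2_eq_square field_simps)
  ultimately have "1 \<le> (1 - x + x\<^sup>2 / 2) * exp x"
    using zero_le_power2[of "x\<^sup>2"] by linarith
  then have "exp (- x) \<le> 1 - x + x\<^sup>2 / 2"
    by (simp add: exp_minus field_simps)
  moreover have "1 - x \<le> exp (- x)"
    using exp_ge_add_one_self[of "- x"] by simp
  ultimately show ?thesis by simp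
qed

lemma (in real_distribution) char_minus_normal_bound:
  fixes t :: real
  assumes mean: "expectation (\<lambda>x. x) = 0" and var: "variance (\<lambda>x. x) = 1"
    and int3: "integrable M (\<lambda>x. \<bar>x\<bar> ^ 3)"
  shows "cmod (char M t - exp (- (t\<^sup>2 / 2))) \<le> \<bar>t\<bar> ^ 3 * (\<integral>x. \<bar>x\<bar> ^ 3 \<partial>M) / 6 + t ^ 4 / 8"
proof -
  \<comment> \<open>This domination derives the integrability of the lower moments from that of the
    third.\<close>
  have le: "\<bar>x\<bar> ^ k \<le> 1 + \<bar>x\<bar> ^ 3" if "k \<le> 3" for x :: real and k
  proof (cases "\<bar>x\<bar> \<le> 1")
    case True
    then show ?thesis using power_le_one[of "\<bar>x\<bar>" k] by (simp add: add_increasing2)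
  next
    case False
    then show ?thesis using power_increasing[OF that, of "\<bar>x\<bar>"] by linarith
  qed
  have int: "integrable M (\<lambda>x. x ^ k)" if "k \<le> 3" for k
    by (rule Bochner_Integration.integrable_bound[where f = "\<lambda>x. 1 + \<bar>x\<bar> ^ 3"])
      (use le[OF that] int3 in \<open>auto simp: power_abs\<close>)
  \<comment> \<open>The factor 1 is the variance in \<open>char_approx3\<close>; only the cubic
    entry of the minimum is kept afterwards.\<close>
  have "cmod (char M t - (1 - t\<^sup>2 * 1 / 2)) \<le>
      t\<^sup>2 / 6 * expectation (\<lambda>x. min (6 * x\<^sup>2) (\<bar>t\<bar> * \<bar>x\<bar> ^ 3))"
    using int[of 1] int[of 2] by (intro char_approx3 mean var) auto
  also have "\<dots> \<le> t\<^sup>2 / 6 * expectation (\<lambda>x. \<bar>t\<bar> * \<bar>x\<bar> ^ 3)"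
    using int3 by (intro mult_left_mono integral_mono_AE' AE_I2) auto
  also have "\<dots> = \<bar>t\<bar> ^ 3 * (\<integral>x. \<bar>x\<bar> ^ 3 \<partial>M) / 6"
    by (simp add: power3_eq_cube power2_eq_square)
  finally have 1: "cmod (char M t - (1 - t\<^sup>2 / 2)) \<le> \<bar>t\<bar> ^ 3 * (\<integral>x. \<bar>x\<bar> ^ 3 \<partial>M) / 6"
    by simp
  have "cmod ((1 - t\<^sup>2 / 2) - exp (- (t\<^sup>2 / 2))) = \<bar>1 - t\<^sup>2 / 2 - exp (- (t\<^sup>2 / 2))\<bar>"
    by (metis norm_of_real of_real_diff of_real_1 of_real_divide of_real_numeral of_real_power)
  also have "\<dots> \<le> (t\<^sup>2 / 2)\<^sup>2 / 2"
    by (rule exp_minus_approx2) simp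
  also have "\<dots> = t ^ 4 / 8"
    by (simp add: power_divide flip: power_mult)
  finally have 2: "cmod ((1 - t\<^sup>2 / 2) - exp (- (t\<^sup>2 / 2))) \<le> t ^ 4 / 8" .
  show ?thesis
    using norm_triangle_le[OF add_mono[OF 1 2]] by simp
qed

text \<open>With t = u / n and e = exp (- t^2 / 2), the prefactor is the inverse of e^n, so the
  difference from 1 is the prefactor times \<open>char M t ^ n - e ^ n\<close>. Both bases have
  modulus at most 1, so taking n-th powers costs only a factor n. Then n |t|^3 = |u|^3 / n^2 and n
  t^4 = u^4 / n^3 give the two terms.\<close>

lemma (in real_distribution) normalized_char_power_bound:
  fixes u :: real and n :: nat
  assumes mean: "expectation (\<lambda>x. x) = 0" and var: "variance (\<lambda>x. x) = 1"
    and int3: "integrable M (\<lambda>x. \<bar>x\<bar> ^ 3)"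
    and n: "1 \<le> n" and u: "\<bar>u\<bar> \<le> R"
  shows "cmod (exp (of_real (u\<^sup>2 / (2 * n))) * char M (u / n) ^ n - 1) \<le>
    exp (R\<^sup>2 / 2) * (R ^ 3 / 6 * ((\<integral>x. \<bar>x\<bar> ^ 3 \<partial>M) / n\<^sup>2) + R ^ 4 / 8 * (1 / n ^ 3))"
proof -
  define t where "t = u / n"
  define e where "e = complex_of_real (exp (- (t\<^sup>2 / 2)))"
  define m where "m = (\<integral>x. \<bar>x\<bar> ^ 3 \<partial>M)"
  have m: "0 \<le> m" by (simp add: m_def)
  have R: "0 \<le> R" using u by linarith
  have nt: "u\<^sup>2 / (2 * n) = n * (t\<^sup>2 / 2)"
    using n by (simp add: t_def power2_eq_square field_simps)
  have "e ^ n = complex_of_real (exp (- (u\<^sup>2 / (2 * n))))"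
    unfolding nt e_def by (simp only: of_real_power[symmetric] exp_of_nat_mult[symmetric] mult_minus_right)
  then have en: "exp (complex_of_real (u\<^sup>2 / (2 * n))) * e ^ n = 1"
    by (simp add: exp_minus flip: exp_of_real)
  have "exp (complex_of_real (u\<^sup>2 / (2 * n))) * char M t ^ n - 1 =
      exp (complex_of_real (u\<^sup>2 / (2 * n))) * (char M t ^ n - e ^ n)"
    using en by (simp add: right_diff_distrib)
  then have "cmod (exp (complex_of_real (u\<^sup>2 / (2 * n))) * char M t ^ n - 1) =
      exp (u\<^sup>2 / (2 * n)) * cmod (char M t ^ n - e ^ n)"
    by (simp add: norm_mult)
  also have "\<dots> \<le> exp (R\<^sup>2 / 2) * (n * (\<bar>t\<bar> ^ 3 * m / 6 + t ^ 4 / 8))"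
  proof (intro mult_mono)
    have "u\<^sup>2 \<le> R\<^sup>2" using u R by (simp add: abs_le_square_iff[symmetric])
    then have "u\<^sup>2 / (2 * n) \<le> R\<^sup>2 / 2"
      using n by (intro frac_le) auto
    then show "exp (u\<^sup>2 / (2 * n)) \<le> exp (R\<^sup>2 / 2)" by simp
    have "cmod (char M t ^ n - e ^ n) \<le> n * cmod (char M t - e)"
      by (intro norm_power_diff cmod_char_le_1) (simp add: e_def)
    also have "\<dots> \<le> n * (\<bar>t\<bar> ^ 3 * m / 6 + t ^ 4 / 8)"
      unfolding e_def m_def by (intro mult_left_mono char_minus_normal_bound mean var int3) auto
    finally show "cmod (char M t ^ n - e ^ n) \<le> n * (\<bar>t\<bar> ^ 3 * m / 6 + t ^ 4 / 8)" .
  qed auto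
  also have "n * (\<bar>t\<bar> ^ 3 * m / 6 + t ^ 4 / 8) = \<bar>u\<bar> ^ 3 / 6 * (m / n\<^sup>2) + \<bar>u\<bar> ^ 4 / 8 * (1 / n ^ 3)"
    using n by (simp add: t_def power_divide field_simps power2_eq_square power3_eq_cube power4_eq_xxxx)
  also have "exp (R\<^sup>2 / 2) * \<dots> \<le> exp (R\<^sup>2 / 2) * (R ^ 3 / 6 * (m / n\<^sup>2) + R ^ 4 / 8 * (1 / n ^ 3))"
    using m u R
    by (intro mult_left_mono add_mono mult_right_mono divide_right_mono power_mono) auto
  finally show ?thesis by (simp add: t_def m_def)
qed

lemma (in prob_space) char_distr_mult:
  assumes [measurable]: "random_variable borel Y"
  shows "char (distr M borel (\<lambda>\<omega>. c * Y \<omega>)) u = char (distr M borel Y) (u * c)"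
  by (simp add: char_def integral_distr mult.assoc)

context prob_space
begin

lemma mod_gaussian_char_eq_char:
  assumes [measurable]: "random_variable borel (Z N)"
  shows "mod_gaussian_char Z \<beta> \<gamma> N u =
    exp (- \<i> * of_real (u * \<beta> N) + of_real (u\<^sup>2 * \<gamma> N / 2)) * char (distr M borel (Z N)) u"
  by (simp add: mod_gaussian_char_def char_def integral_distr)

lemma continuous_on_mod_gaussian_char:
  assumes "random_variable borel (Z N)"
  shows "continuous_on K (mod_gaussian_char Z \<beta> \<gamma> N)"
proof -
  have "continuous_on K (char (distr M borel (Z N)))"
    using real_distribution.isCont_char[OF real_distribution_distr[OF assms]]
    by (intro continuous_at_imp_continuous_on) auto
  then show ?thesis
    unfolding mod_gaussian_char_eq_char[where Z = Z and N = N, OF assms, abs_def]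
    by (auto intro!: continuous_intros)
qed

lemma uniform_limit_mod_gaussian_char_continuous_on:
  assumes rv: "\<And>N. 1 \<le> N \<Longrightarrow> random_variable borel (Z N)"
    and lim: "uniform_limit K (mod_gaussian_char Z \<beta> \<gamma>) \<Phi> sequentially"
  shows "continuous_on K \<Phi>"
proof (rule uniform_limit_theorem[OF _ lim])
  show "\<forall>\<^sub>F N in sequentially. continuous_on K (mod_gaussian_char Z \<beta> \<gamma> N)"
    using eventually_ge_at_top[of 1]
    by eventually_elim (intro continuous_on_mod_gaussian_char rv)
qed simp

text \<open>Defining \<open>\<Phi>\<close> as the pointwise limit makes it the same for all compact
  sets. The unit ball then gives continuity at 0, and singletons give pointwise convergence.\<close>

lemma strongly_mod_gaussian_converges_exI:
  assumes rv: "\<And>N. 1 \<le> N \<Longrightarrow> random_variable borel (Z N)"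
    and nonneg: "\<And>N. 1 \<le> N \<Longrightarrow> 0 \<le> \<gamma> N"
    and conv: "\<And>K. compact K \<Longrightarrow> uniformly_convergent_on K (mod_gaussian_char Z \<beta> \<gamma>)"
  shows "\<exists>\<Phi>. strongly_mod_gaussian_converges Z \<beta> \<gamma> \<Phi>"
proof -
  define \<Phi> where "\<Phi> u = lim (\<lambda>N. mod_gaussian_char Z \<beta> \<gamma> N u)" for u
  have lim: "uniform_limit K (mod_gaussian_char Z \<beta> \<gamma>) \<Phi> sequentially" if "compact K" for K
    using conv[OF that] by (simp add: uniformly_convergent_uniform_limit_iff \<Phi>_def[abs_def])
  have "continuous_on (cball 0 1) \<Phi>"
    using lim[of "cball 0 1"] by (intro uniform_limit_mod_gaussian_char_continuous_on[OF rv]) auto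
  then have "isCont \<Phi> 0"
    by (rule continuous_on_interior) simp
  moreover have "(\<lambda>N. mod_gaussian_char Z \<beta> \<gamma> N u) \<longlonglongrightarrow> \<Phi> u" for u
    using lim[of "{u}"] by simp
  ultimately show ?thesis
    using rv nonneg lim
    unfolding strongly_mod_gaussian_converges_def mod_gaussian_converges_def by blast
qed

text \<open>The two normalisations differ by the factor exp (u^2 (\<gamma>' N - \<gamma> N) / 2),
  which converges uniformly on \<open>K\<close>. Measurability serves to make the old limit
  continuous, hence bounded on \<open>K\<close>.\<close>

lemma uniformly_convergent_mod_gaussian_char_shift:
  assumes rv: "\<And>N. 1 \<le> N \<Longrightarrow> random_variable borel (Z N)"
    and K: "compact K"
    and conv: "uniformly_convergent_on K (mod_gaussian_char Z \<beta> \<gamma>)"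
    and c: "(\<lambda>N. \<gamma>' N - \<gamma> N) \<longlonglongrightarrow> c"
  shows "uniformly_convergent_on K (mod_gaussian_char Z \<beta> \<gamma>')"
proof -
  let ?g = "\<lambda>N u. u\<^sup>2 / 2 * (\<gamma>' N - \<gamma> N)" and ?e = "\<lambda>x::real. exp (complex_of_real x)"
  obtain \<Phi> where lim: "uniform_limit K (mod_gaussian_char Z \<beta> \<gamma>) \<Phi> sequentially"
    using conv by (auto simp: uniformly_convergent_on_def)
  have bK: "bounded ((\<lambda>u::real. u\<^sup>2 / 2) ` K)"
    by (intro compact_imp_bounded compact_continuous_image continuous_intros K) auto
  then obtain A where A: "\<And>u. u \<in> K \<Longrightarrow> u\<^sup>2 / 2 \<le> A"
    by (auto simp: bounded_iff)
  obtain C where C: "\<And>N. \<bar>\<gamma>' N - \<gamma> N\<bar> \<le> C"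
    using convergent_imp_Bseq[OF convergentI[OF c]] by (auto simp: Bseq_def)
  have gC: "\<bar>u\<^sup>2 / 2 * d\<bar> \<le> A * C" if "u \<in> K" "\<bar>d\<bar> \<le> C" for u d :: real
    using mult_mono[OF A[OF that(1)] that(2)] A[OF that(1)] by (simp add: abs_mult order_trans[of 0 "u\<^sup>2 / 2"])
  have cC: "\<bar>c\<bar> \<le> C"
    by (rule tendsto_upperbound[OF tendsto_rabs[OF c]]) (auto simp: C)
  have "uniform_limit K (\<lambda>N u. \<gamma>' N - \<gamma> N) (\<lambda>u. c) sequentially"
    using c by (auto simp: uniform_limit_iff tendsto_iff elim: eventually_mono)
  then have "uniform_limit K ?g (\<lambda>u. u\<^sup>2 / 2 * c) sequentially"
    using bK by (intro uniform_lim_mult uniform_limit_const) (auto simp: bounded_iff)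
  \<comment> \<open>The exponential is uniformly continuous on bounded intervals only. Since
    \<open>A\<close> bounds u^2 / 2 on \<open>K\<close> and \<open>C\<close> bounds all differences
    and their limit, every exponent stays in this interval.\<close>
  moreover have "uniformly_continuous_on {- (A * C)..A * C} ?e"
    by (intro compact_uniformly_continuous continuous_intros) auto
  ultimately have "uniform_limit K (\<lambda>N u. ?e (?g N u)) (?e \<circ> (\<lambda>u. u\<^sup>2 / 2 * c)) sequentially"
  proof (rule uniform_limit_compose)
    have in_interval: "(\<lambda>u. u\<^sup>2 / 2 * d) ` K \<subseteq> {- (A * C)..A * C}" if "\<bar>d\<bar> \<le> C" for d
    proof (rule image_subsetI)
      fix u assume "u \<in> K"
      from gC[OF this that] show "u\<^sup>2 / 2 * d \<in> {- (A * C)..A * C}"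
        unfolding atLeastAtMost_iff by linarith
    qed
    show "\<forall>\<^sub>F N in sequentially. ?g N ` K \<subseteq> {- (A * C)..A * C}"
      by (intro always_eventually allI in_interval C)
    show "(\<lambda>u. u\<^sup>2 / 2 * c) ` K \<subseteq> {- (A * C)..A * C}"
      by (rule in_interval[OF cC])
  qed
  \<comment> \<open>A product of uniform limits is uniform once both limits are bounded.\<close>
  moreover have "bounded ((?e \<circ> (\<lambda>u. u\<^sup>2 / 2 * c)) ` K)"
    by (intro compact_imp_bounded compact_continuous_image K) (auto intro!: continuous_intros)
  moreover have "bounded (\<Phi> ` K)"
    by (intro compact_imp_bounded compact_continuous_image K
        uniform_limit_mod_gaussian_char_continuous_on[OF rv lim])
  ultimately have "uniform_limit K (\<lambda>N u. ?e (?g N u) * mod_gaussian_char Z \<beta> \<gamma> N u)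
      (\<lambda>u. (?e \<circ> (\<lambda>u. u\<^sup>2 / 2 * c)) u * \<Phi> u) sequentially"
    by (intro uniform_lim_mult lim)
  moreover have "?e (?g N u) * mod_gaussian_char Z \<beta> \<gamma> N u = mod_gaussian_char Z \<beta> \<gamma>' N u" for N u
    by (simp add: mod_gaussian_char_def right_diff_distrib diff_divide_distrib flip: exp_add mult.assoc)
  ultimately show ?thesis
    by (auto simp: uniformly_convergent_on_def)
qed

end

theorem theorem3p1:
  fixes M :: "'a measure"
    and X :: "nat \<Rightarrow> nat \<Rightarrow> 'a \<Rightarrow> real"
    and \<mu> :: "nat \<Rightarrow> real measure"
    and m :: "nat \<Rightarrow> real"
    and Z :: "nat \<Rightarrow> 'a \<Rightarrow> real"
  assumes "prob_space M"
    and "prob_space.indep_vars M (\<lambda>_. borel) (\<lambda>(n, i). X n i) {(n, i). 1 \<le> n \<and> 1 \<le> i \<and> i \<le> n}"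
    and "\<And>n i. 1 \<le> n \<Longrightarrow> 1 \<le> i \<Longrightarrow> i \<le> n \<Longrightarrow> distr M borel (X n i) = \<mu> n"
    and "\<And>n. 1 \<le> n \<Longrightarrow> prob_space.expectation (\<mu> n) (\<lambda>x. x) = 0"
    and "\<And>n. 1 \<le> n \<Longrightarrow> prob_space.variance (\<mu> n) (\<lambda>x. x) = 1"
    and "\<And>n. 1 \<le> n \<Longrightarrow> integrable (\<mu> n) (\<lambda>x. \<bar>x\<bar> ^ 3)"
    and "\<And>n. 1 \<le> n \<Longrightarrow> m n = (\<integral>x. \<bar>x\<bar> ^ 3 \<partial>\<mu> n)"
    and "summable (\<lambda>k. m (Suc k) / (real (Suc k))\<^sup>2)"
    and "\<And>N \<omega>. 1 \<le> N \<Longrightarrow> Z N \<omega> = (\<Sum>n = 1..N. (1 / real n) * (\<Sum>i = 1..n. X n i \<omega>))"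
  shows "(\<exists>\<Phi>. prob_space.strongly_mod_gaussian_converges M Z (\<lambda>_. 0) (\<lambda>N. harm N) \<Phi>)
       \<and> (\<exists>\<Phi>. prob_space.strongly_mod_gaussian_converges M Z (\<lambda>_. 0) (\<lambda>N. ln (real N)) \<Phi>)"
proof -
  interpret prob_space M by fact
  define I where "I = {(n, i). 1 \<le> n \<and> 1 \<le> i \<and> i \<le> (n::nat)}"
  \<comment> \<open>\<open>h n\<close> is the factor of row \<open>Suc n\<close>, shifted so that
    products start at 0 as the summability hypothesis does.\<close>
  define h where "h n u = exp (complex_of_real (u\<^sup>2 / (2 * real (Suc n)))) *
    char (\<mu> (Suc n)) (u / real (Suc n)) ^ Suc n" for n u
  note indep = assms(2)[folded I_def]
  have X[measurable]: "random_variable borel (X n i)" if "1 \<le> n" "1 \<le> i" "i \<le> n" for n i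
    using indep that unfolding indep_vars_def by (auto simp: I_def)
  \<comment> \<open>Row n is nonempty, so \<open>\<mu> n\<close> is the law of its first
    entry.\<close>
  have real_distr: "real_distribution (\<mu> n)" if "1 \<le> n" for n
    using real_distribution_distr[OF X[of n 1]] assms(3)[of n 1] that by (simp del: real_distribution_distr)
  have Z_eq: "Z N = (\<lambda>\<omega>. \<Sum>(n, i)\<in>Sigma {1..N} (\<lambda>n. {1..n}). (1 / real n) * X n i \<omega>)" if "1 \<le> N" for N
    by (simp add: assms(9)[OF that] fun_eq_iff sum_distrib_left sum.Sigma)
  have rv: "random_variable borel (Z N)" if "1 \<le> N" for N
    unfolding Z_eq[OF that] by (auto intro!: borel_measurable_sum borel_measurable_times X simp: split_beta)

  \<comment> \<open>Independence over the whole triangle factorises the characteristic function,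
    with n equal factors from row n. \<open>Z 0\<close> is unconstrained, hence
    \<open>1 \<le> N\<close>.\<close>
  have char_eq: "mod_gaussian_char Z (\<lambda>_. 0) harm N u = (\<Prod>k<N. h k u)" if "1 \<le> N" for N u
  proof -
    let ?S = "Sigma {1..N} (\<lambda>n. {1..n})"
    have "indep_vars (\<lambda>_. borel) (\<lambda>p \<omega>. (1 / real (fst p)) * (case p of (n, i) \<Rightarrow> X n i) \<omega>) ?S"
      by (rule indep_vars_compose2[where Y = "\<lambda>p x. (1 / real (fst p)) * x",
          OF indep_vars_subset[OF indep]]) (auto simp: I_def)
    then have "char (distr M borel (\<lambda>\<omega>. \<Sum>p\<in>?S. (1 / real (fst p)) * (case p of (n, i) \<Rightarrow> X n i) \<omega>)) u =
        (\<Prod>p\<in>?S. char (distr M borel (\<lambda>\<omega>. (1 / real (fst p)) * (case p of (n, i) \<Rightarrow> X n i) \<omega>)) u)"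
      by (rule char_distr_sum)
    also have "\<dots> = (\<Prod>(n, i)\<in>?S. char (\<mu> n) (u / n))"
      by (intro prod.cong refl) (auto simp: char_distr_mult X assms(3) simp del: times_divide_eq_left)
    also have "\<dots> = (\<Prod>n = 1..N. char (\<mu> n) (u / n) ^ n)"
      by (subst prod.Sigma[symmetric]) auto
    also have "\<dots> = (\<Prod>k<N. char (\<mu> (Suc k)) (u / real (Suc k)) ^ Suc k)"
      by (rule prod.reindex_bij_witness[of _ Suc "\<lambda>n. n - 1"]) auto
    finally have Z: "char (distr M borel (Z N)) u = (\<Prod>k<N. char (\<mu> (Suc k)) (u / real (Suc k)) ^ Suc k)"
      by (simp add: Z_eq[OF that] split_beta)
    have "u\<^sup>2 * harm N / 2 = (\<Sum>k<N. u\<^sup>2 / (2 * real (Suc k)))"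
      by (induction N) (simp_all add: harm_expand(1) harm_Suc field_simps)
    then have "exp (complex_of_real (u\<^sup>2 * harm N / 2)) = (\<Prod>k<N. exp (complex_of_real (u\<^sup>2 / (2 * real (Suc k)))))"
      by (simp only: of_real_sum exp_sum[OF finite_lessThan])
    then show ?thesis
      by (simp add: mod_gaussian_char_eq_char[of Z N, OF rv[OF that]] Z h_def prod.distrib)
  qed

  have conv: "uniformly_convergent_on K (mod_gaussian_char Z (\<lambda>_. 0) harm)" if K: "compact K" for K
  proof -
    obtain R where R: "\<And>u. u \<in> K \<Longrightarrow> \<bar>u\<bar> \<le> R"
      using compact_imp_bounded[OF K] by (auto simp: bounded_iff)
    \<comment> \<open>This is the bound of \<open>normalized_char_power_bound\<close> for row
      \<open>Suc k\<close>, free of u; it is summable by the moment hypothesis and the convergence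
      of the series of 1 / n^3.\<close>
    define B where "B k = exp (R\<^sup>2 / 2) * (R ^ 3 / 6 * (m (Suc k) / (real (Suc k))\<^sup>2) +
      R ^ 4 / 8 * (1 / real (Suc k) ^ 3))" for k
    have "summable (\<lambda>k. 1 / real (Suc k) ^ 3)"
      using inverse_power_summable[of 3, where 'a = real]
      by (subst summable_Suc_iff) (simp add: inverse_eq_divide)
    from assms(8) this have B: "summable B"
      unfolding B_def by (rule summable_mult[OF summable_add[OF summable_mult summable_mult]])
    \<comment> \<open>The outer norm is the one in the M-test, applied here to the series of the
      real functions \<open>norm (h k u - 1)\<close>.\<close>
    have "norm (norm (h k u - 1)) \<le> B k" if "u \<in> K" for k u
    proof -
      interpret \<mu>: real_distribution "\<mu> (Suc k)" by (rule real_distr) simp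
      show ?thesis
        using \<mu>.normalized_char_power_bound[of "Suc k" u R] assms(4-7)[of "Suc k"] R[OF that]
        by (simp add: h_def B_def del: power_Suc)
    qed
    then have "uniformly_convergent_on K (\<lambda>N u. \<Sum>k<N. norm (h k u - 1))"
      using B by (rule Weierstrass_m_test')
    moreover have "continuous_on K (h k)" for k
    proof -
      have "continuous_on UNIV (char (\<mu> (Suc k)))"
        using real_distribution.isCont_char[OF real_distr[of "Suc k"]]
        by (intro continuous_at_imp_continuous_on) auto
      then have "continuous_on K (\<lambda>u. char (\<mu> (Suc k)) (u / real (Suc k)))"
        by (rule continuous_on_compose2) (auto intro!: continuous_intros)
      then show ?thesis
        unfolding h_def[abs_def] by (intro continuous_intros) auto
    qed
    \<comment> \<open>On a compact set, continuous factors whose distances to 1 have a uniformly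
      convergent sum give a uniformly convergent product.\<close>
    ultimately have prod: "uniformly_convergent_on K (\<lambda>N u. \<Prod>k<N. h k u)"
      by (intro uniformly_convergent_on_prod' K)
    have "\<forall>\<^sub>F N in sequentially. \<forall>u\<in>K. (\<Prod>k<N. h k u) = mod_gaussian_char Z (\<lambda>_. 0) harm N u"
      using eventually_ge_at_top[of 1] by eventually_elim (simp add: char_eq)
    from uniformly_convergent_cong[OF this refl] prod show ?thesis
      by (rule iffD1)
  qed

  have "(\<lambda>N. ln (real N) - harm N) \<longlonglongrightarrow> - euler_mascheroni"
    using tendsto_minus[OF euler_mascheroni_LIMSEQ] by simp
  note shift = uniformly_convergent_mod_gaussian_char_shift[OF rv _ conv this]
  show ?thesis
    by (intro conjI strongly_mod_gaussian_converges_exI rv conv shift) (auto simp: harm_nonneg)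
qed

end
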